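(* If the symmetric group $S_4$ acts on a finite set $X$, then $D_{S_4}(X)\in\{1,2,3,4\}$. If $S_4$ acts faithfully on $X$, then $D_{S_4}(X)\in\{2,3,4\}$.
   Context: For a group $\Gamma$ acting on a set $X$, write $g.x$ for the action and $\mathrm{Stab}_\Gamma(Y)=\{g\in\Gamma: g.y=y \text{ for all } y\in Y\}$. The action is faithful if $\mathrm{Stab}_\Gamma(X)$ is trivial. A labelling $\phi:X\to\{1,\dots,k\}$ is $k$-distinguishing if $\{g\in\Gamma:\phi(g.x)=\phi(x)\text{ for all }x\}=\mathrm{Stab}_\Gamma(X)$. The distinguishing number $D_\Gamma(X)$ is the minimum $k$ for which a $k$-distinguishing labelling exists. *)

theory Defs
  imports "HOL-Algebra.Sym_Groups" "HOL-Algebra.Group_Action"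
begin

definition pointwise_stabilizer ::
    "('g, 'm) monoid_scheme \<Rightarrow> ('g \<Rightarrow> 'x \<Rightarrow> 'x) \<Rightarrow> 'x set \<Rightarrow> 'g set"
  where "pointwise_stabilizer G act Y = {g \<in> carrier G. \<forall>y \<in> Y. act g y = y}"

definition distinguishing_labelling ::
    "('g, 'm) monoid_scheme \<Rightarrow> 'x set \<Rightarrow> ('g \<Rightarrow> 'x \<Rightarrow> 'x) \<Rightarrow> nat \<Rightarrow> ('x \<Rightarrow> nat) \<Rightarrow> bool"
  where "distinguishing_labelling G X act k f \<longleftrightarrow>
    f \<in> X \<rightarrow> {1..k} \<and>
    {g \<in> carrier G. \<forall>x \<in> X. f (act g x) = f x} = pointwise_stabilizer G act X"

text \<open>
  The number of labels is taken to be positive. This matters only for the empty set, which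
  would otherwise admit a labelling with \<^term>\<open>0::nat\<close> labels.
\<close>

definition distinguishing_number ::
    "('g, 'm) monoid_scheme \<Rightarrow> 'x set \<Rightarrow> ('g \<Rightarrow> 'x \<Rightarrow> 'x) \<Rightarrow> nat"
  where "distinguishing_number G X act =
    (LEAST k. k \<ge> 1 \<and> (\<exists>f. distinguishing_labelling G X act k f))"

lemma ex_distinguishing_labelling:
  fixes X :: "'x set"
  assumes "group_action G X act" and "finite X"
  shows "\<exists>k \<ge> 1. \<exists>f. distinguishing_labelling G X act k f"
proof -
  interpret group_action G X act by fact
  obtain h :: "'x \<Rightarrow> nat" and n where h: "h ` X = {i. i < n}" "inj_on h X"
    using finite_imp_inj_to_nat_seg[OF \<open>finite X\<close>] by blast
  define f where "f = Suc \<circ> h"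
  have inj: "inj_on f X"
    using h(2) by (auto simp: f_def inj_on_def)
  have "h x < n" if "x \<in> X" for x
    using h(1) that by blast
  then have "f \<in> X \<rightarrow> {1..Suc n}"
    by (auto simp: f_def less_imp_le)
  moreover have "f (act g x) = f x \<longleftrightarrow> act g x = x" if "g \<in> carrier G" "x \<in> X" for g x
    using that inj element_image[OF that refl] by (auto dest: inj_onD)
  ultimately have "distinguishing_labelling G X act (Suc n) f"
    unfolding distinguishing_labelling_def pointwise_stabilizer_def by auto
  then show ?thesis by (intro exI[of _ "Suc n"]) auto
qed

lemma faithful_action_iff_pointwise_stabilizer:
  assumes "group_action G X act"
  shows "faithful_action G X act \<longleftrightarrow> pointwise_stabilizer G act X = {\<one>\<^bsub>G\<^esub>}"
proof -
  interpret group_action G X act by fact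
  interpret hom: group_hom G "BijGroup X" act by (rule group_hom)
  have "act g = \<one>\<^bsub>BijGroup X\<^esub> \<longleftrightarrow> (\<forall>x \<in> X. act g x = x)" if "g \<in> carrier G" for g
  proof -
    have "act g \<in> extensional X"
      using bij_prop0[OF that] by (rule Bij_imp_extensional)
    then show ?thesis
      by (auto simp: BijGroup_def extensional_def restrict_def fun_eq_iff)
  qed
  then have "kernel G (BijGroup X) act = pointwise_stabilizer G act X"
    by (auto simp: kernel_def pointwise_stabilizer_def)
  then show ?thesis
    using assms hom.inj_iff_trivial_ker
    by (simp add: faithful_action_def faithful_action_axioms_def)
qed

end

theory Submission
  imports Defs
begin

text \<open>
  More generally, a group of order at most \<open>k!\<close> admits a distinguishing labelling with \<open>k\<close> labels.
  If every orbit has at most \<open>k\<close> points, label each orbit injectively. Otherwise some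
  point \<open>y\<close> has an orbit with more than \<open>k\<close> points, so its stabilizer has order at most \<open>(k - 1)!\<close>;
  give \<open>y\<close> a label of its own and label the remaining points by induction. The symmetric group
  on four points has order \<open>4!\<close>.
\<close>

text \<open>The action restricts to \<open>H\<close>, so the orbit-stabilizer theorem applies there.
  The stabilizer in \<open>H\<close> is \<open>H\<close> intersected with the stabilizer in
  \<open>G\<close>, hence again a subgroup of \<open>G\<close> to which an induction can
  pass.\<close>

lemma (in group_action) subgroup_orbit_stabilizer:
  assumes H: "subgroup H G" and y: "y \<in> E"
  shows "card ((\<lambda>h. \<phi> h y) ` H) * card {h \<in> H. \<phi> h y = y} = card H"
    and "subgroup {h \<in> H. \<phi> h y = y} G"
proof -
  let ?G' = "G\<lparr>carrier := H\<rparr>"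
  interpret sub: group_action ?G' E \<phi>
    using H by (rule induced_action)
  have orb: "orbit ?G' \<phi> y = (\<lambda>h. \<phi> h y) ` H"
    by (auto simp: orbit_def)
  have stab: "stabilizer ?G' \<phi> y = {h \<in> H. \<phi> h y = y}"
    by (auto simp: stabilizer_def)
  show "card ((\<lambda>h. \<phi> h y) ` H) * card {h \<in> H. \<phi> h y = y} = card H"
    using sub.orbit_stabilizer_theorem[OF y] by (simp add: orb stab order_def)
  have "{h \<in> H. \<phi> h y = y} = H \<inter> stabilizer G \<phi> y"
    using subgroup.subset[OF H] by (auto simp: stabilizer_def)
  then show "subgroup {h \<in> H. \<phi> h y = y} G"
    using H stabilizer_subgroup[OF y] group.subgroups_Inter_pair group_hom.axioms(1)[OF group_hom] by metis
qed

text \<open>Both \<open>H\<close> and the \<open>H\<close>-invariant set \<open>Y\<close> vary,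
  because the induction step replaces them by the stabilizer of a point \<open>y\<close> and by
  \<open>Y - {y}\<close>. One implication suffices: an element fixing \<open>Y\<close> pointwise
  preserves every labelling.\<close>

lemma (in group_action) ex_distinguishing_labelling_of_card_le_fact:
  assumes "1 \<le> k" "subgroup H G" "finite H" "card H \<le> fact k"
    and "Y \<subseteq> E" "\<And>h y. h \<in> H \<Longrightarrow> y \<in> Y \<Longrightarrow> \<phi> h y \<in> Y"
  shows "\<exists>f. f \<in> Y \<rightarrow> {1..k} \<and>
    (\<forall>h\<in>H. (\<forall>y\<in>Y. f (\<phi> h y) = f y) \<longrightarrow> (\<forall>y\<in>Y. \<phi> h y = y))"
  using assms
proof (induction k arbitrary: H Y rule: nat_induct_at_least)
  case base
  have "\<one>\<^bsub>G\<^esub> \<in> H"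
    using base.prems(1) by (rule subgroup.one_closed)
  with base.prems have "H = {\<one>\<^bsub>G\<^esub>}"
    by (metis card_le_Suc0_iff_eq fact_1 One_nat_def singletonI subsetI subset_antisym subset_singletonD empty_iff)
  moreover have "\<phi> \<one>\<^bsub>G\<^esub> y = y" if "y \<in> Y" for y
    using that base.prems(4) id_eq_one by (metis restrict_apply' subsetD)
  ultimately show ?case
    by (intro exI[of _ "\<lambda>_. 1"]) auto
next
  case (Suc k)
  let ?O = "\<lambda>y. (\<lambda>h. \<phi> h y) ` H"
  show ?case
  proof (cases "\<exists>y\<in>Y. Suc k < card (?O y)")
    case True
    then obtain y where y: "y \<in> Y" and big: "Suc k < card (?O y)"
      by blast
    let ?S = "{h \<in> H. \<phi> h y = y}"
    have yE: "y \<in> E"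
      using y Suc.prems(4) by blast
    note S = subgroup_orbit_stabilizer[OF Suc.prems(1) yE]
    have "Suc k * card ?S \<le> card (?O y) * card ?S"
      using big by (intro mult_right_mono) auto
    also have "\<dots> \<le> Suc k * fact k"
      using S(1) Suc.prems(3) by simp
    finally have card: "card ?S \<le> fact k"
      by (simp only: Suc_mult_le_cancel1)
    \<comment> \<open>Elements of \<open>?S\<close> fix \<open>y\<close> and act injectively, so
      \<open>Y - {y}\<close> is \<open>?S\<close>-invariant.\<close>
    have inj: "\<phi> h z \<noteq> y" if "h \<in> ?S" "z \<in> Y - {y}" for h z
    proof
      assume "\<phi> h z = y"
      moreover have "inj_on (\<phi> h) E"
        using that(1) subgroup.mem_carrier[OF Suc.prems(1)] by (auto intro: inj_prop)
      moreover have "\<phi> h y = y" "z \<in> E"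
        using that Suc.prems(4) by auto
      ultimately have "z = y"
        using yE by (metis inj_onD)
      with that(2) show False
        by simp
    qed
    have "\<exists>f. f \<in> (Y - {y}) \<rightarrow> {1..k} \<and>
        (\<forall>h\<in>?S. (\<forall>z\<in>Y - {y}. f (\<phi> h z) = f z) \<longrightarrow> (\<forall>z\<in>Y - {y}. \<phi> h z = z))"
    proof (rule Suc.IH[OF S(2) _ card])
      show "finite ?S"
        using Suc.prems(2) by simp
      show "Y - {y} \<subseteq> E"
        using Suc.prems(4) by blast
      show "\<phi> h z \<in> Y - {y}" if "h \<in> ?S" "z \<in> Y - {y}" for h z
        using inj[OF that] that Suc.prems(5)[of h z] by blast
    qed
    then obtain f where f: "f \<in> (Y - {y}) \<rightarrow> {1..k}"
      and dist: "\<And>h z. \<lbrakk>h \<in> ?S; \<forall>z\<in>Y - {y}. f (\<phi> h z) = f z; z \<in> Y - {y}\<rbrakk> \<Longrightarrow> \<phi> h z = z"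
      by blast
    have fk: "f z \<noteq> Suc k" if "z \<in> Y - {y}" for z
    proof -
      have "f z \<in> {1..k}"
        using f that by (rule funcset_mem)
      then show ?thesis
        by simp
    qed
    \<comment> \<open>The label \<open>Suc k\<close> is fresh, so any element of \<open>H\<close>
      preserving \<open>?f\<close> fixes \<open>y\<close> and lies in \<open>?S\<close>, where
      \<open>dist\<close> applies.\<close>
    let ?f = "f(y := Suc k)"
    have "\<phi> h z = z" if h: "h \<in> H" and pres: "\<forall>z\<in>Y. ?f (\<phi> h z) = ?f z" and z: "z \<in> Y" for h z
    proof -
      have "?f (\<phi> h y) = Suc k"
        using pres y by auto
      then have hy: "\<phi> h y = y"
        using fk[of "\<phi> h y"] Suc.prems(5)[OF h y] by (auto split: if_splits)
      then have hS: "h \<in> ?S"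
        using h by simp
      have "\<forall>z\<in>Y - {y}. f (\<phi> h z) = f z"
      proof
        fix w
        assume w: "w \<in> Y - {y}"
        then have "?f (\<phi> h w) = ?f w"
          using pres by blast
        with w inj[OF hS w] show "f (\<phi> h w) = f w"
          by simp
      qed
      with dist[OF hS] hy z show ?thesis
        by blast
    qed
    moreover have "?f \<in> Y \<rightarrow> {1..Suc k}"
      using f by fastforce
    ultimately show ?thesis
      by blast
  next
    case False
    have "\<exists>f. f ` A \<subseteq> {1..Suc k} \<and> inj_on f A" if "A \<in> ?O ` Y" for A
      using that False Suc.prems(2) by (intro card_le_inj) (auto simp: not_less)
    \<comment> \<open>The choice is indexed by the orbit as a set, so that all points of one orbit
      are labelled by the same injection.\<close>
    then obtain F where F: "\<And>A. A \<in> ?O ` Y \<Longrightarrow> F A ` A \<subseteq> {1..Suc k} \<and> inj_on (F A) A"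
      by metis
    have self: "z \<in> ?O z" if "z \<in> Y" for z
    proof -
      have "\<phi> \<one>\<^bsub>G\<^esub> z = z"
        using that Suc.prems(4) id_eq_one by (metis restrict_apply' subsetD)
      then show ?thesis
        using subgroup.one_closed[OF Suc.prems(1)] by force
    qed
    \<comment> \<open>Both orbits contain \<open>\<phi> h z\<close>, and distinct orbits are
      disjoint.\<close>
    have same: "?O (\<phi> h z) = ?O z" if h: "h \<in> H" and z: "z \<in> Y" for h z
    proof -
      interpret sub: group_action "G\<lparr>carrier := H\<rparr>" E \<phi>
        using Suc.prems(1) by (rule induced_action)
      have orb: "orbit (G\<lparr>carrier := H\<rparr>) \<phi> w = ?O w" for w
        by (auto simp: orbit_def)
      have E: "z \<in> E" "\<phi> h z \<in> E"
        using z Suc.prems(4,5) h by blast+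
      have "?O z \<in> orbits (G\<lparr>carrier := H\<rparr>) E \<phi>" "?O (\<phi> h z) \<in> orbits (G\<lparr>carrier := H\<rparr>) E \<phi>"
        using E unfolding orbits_def orb by blast+
      moreover have "\<phi> h z \<in> ?O (\<phi> h z) \<inter> ?O z"
        using self[OF Suc.prems(5)[OF h z]] h by blast
      ultimately show ?thesis
        using sub.disjoint_union by blast
    qed
    let ?f = "\<lambda>z. F (?O z) z"
    have "?f \<in> Y \<rightarrow> {1..Suc k}"
    proof
      fix z
      assume z: "z \<in> Y"
      then show "?f z \<in> {1..Suc k}"
        using F[OF imageI[OF z]] self[OF z] by blast
    qed
    moreover have "\<phi> h z = z" if h: "h \<in> H" and pres: "\<forall>z\<in>Y. ?f (\<phi> h z) = ?f z" and z: "z \<in> Y" for h z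
    proof -
      have "F (?O z) (\<phi> h z) = F (?O z) z"
        using pres z same[OF h z] by auto
      moreover have "\<phi> h z \<in> ?O z"
        using h by blast
      ultimately show ?thesis
        using F[OF imageI[OF z]] self[OF z] by (blast dest: inj_onD)
    qed
    ultimately show ?thesis
      by blast
  qed
qed

theorem theorem3p1:
  fixes X :: "'x set" and act :: "(nat \<Rightarrow> nat) \<Rightarrow> 'x \<Rightarrow> 'x"
  assumes "finite X" and "group_action (sym_group 4) X act"
  shows "distinguishing_number (sym_group 4) X act \<in> {1, 2, 3, 4} \<and>
    (faithful_action (sym_group 4) X act \<longrightarrow>
      distinguishing_number (sym_group 4) X act \<in> {2, 3, 4})"
proof -
  let ?G = "sym_group 4"
  let ?P = "\<lambda>k. k \<ge> 1 \<and> (\<exists>f. distinguishing_labelling ?G X act k f)"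
  let ?D = "distinguishing_number ?G X act"
  interpret group_action ?G X act by fact
  have card: "card (carrier ?G) = fact 4"
    by (rule sym_group_card_carrier)
  \<comment> \<open>This is the case where \<open>H\<close> is the whole group, \<open>Y\<close> is
    \<open>X\<close> and \<open>k\<close> is 4. The carrier is finite because its cardinality is
    positive.\<close>
  have "\<exists>f. f \<in> X \<rightarrow> {1..4::nat} \<and>
    (\<forall>h\<in>carrier ?G. (\<forall>y\<in>X. f (act h y) = f y) \<longrightarrow> (\<forall>y\<in>X. act h y = y))"
    using card element_image
    by (intro ex_distinguishing_labelling_of_card_le_fact)
      (auto simp: group.subgroup_self sym_group_is_group intro: card_ge_0_finite)
  then obtain f where "f \<in> X \<rightarrow> {1..4::nat}"
    "\<And>h y. \<lbrakk>h \<in> carrier ?G; \<forall>y\<in>X. f (act h y) = f y; y \<in> X\<rbrakk> \<Longrightarrow> act h y = y"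
    by blast
  then have "distinguishing_labelling ?G X act 4 f"
    unfolding distinguishing_labelling_def pointwise_stabilizer_def by auto
  then have P4: "?P 4"
    by auto
  have PD: "?P ?D" and D4: "?D \<le> 4"
    unfolding distinguishing_number_def
    using LeastI[of ?P, OF P4] Least_le[of ?P, OF P4] by blast+
  have "?D \<noteq> 1" if "faithful_action ?G X act"
  proof
    assume "?D = 1"
    with PD obtain f where f: "f \<in> X \<rightarrow> {1::nat}"
      and eq: "{g \<in> carrier ?G. \<forall>x \<in> X. f (act g x) = f x} = pointwise_stabilizer ?G act X"
      unfolding distinguishing_labelling_def by auto
    \<comment> \<open>A constant labelling is preserved by the whole group, so a faithful action
      would force the group to be trivial, although it has 24 elements.\<close>
    have "f (act g x) = f x" if "g \<in> carrier ?G" "x \<in> X" for g x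
      using f that element_image[OF that refl] by (simp add: Pi_iff)
    then have "carrier ?G = {\<one>\<^bsub>?G\<^esub>}"
      using eq that faithful_action_iff_pointwise_stabilizer[OF assms(2)] by auto
    with card show False
      by (simp add: fact_numeral)
  qed
  with PD D4 show ?thesis
    by auto
qed

end
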